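(* Let $k\ge 1$ be an integer and let $G$ be an undirected graph. If $G$ is $(2k+2)$-edge-connected, then the edge-flip graph $\mathcal{G}_k(G)$ is connected.
   Context: Graphs are finite; multiple edges are allowed, and each edge joins two distinct vertices. An undirected graph $G=(V,E)$ is $m$-edge-connected if every non-empty $S\subsetneq V$ has at least $m$ edges with exactly one endpoint in $S$. An orientation of $G$ is a directed graph obtained by choosing, for each undirected edge $\{u,v\}\in E$, one of the directed edges $(u,v)$ or $(v,u)$; parallel edges are oriented individually. A directed graph $D=(V,A)$ is $k$-edge-connected if for every non-empty $S\subsetneq V$ at least $k$ edges leave $S$ and at least $k$ edges enter $S$. An edge flip reverses the direction of exactly one directed edge. The edge-flip graph $\mathcal{G}_k(G)$ is the undirected graph whose vertices are all $k$-edge-connected orientations of $G$, two orientations being adjacent if and only if one is obtained from the other by a single edge flip. *)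

theory Defs
  imports "Graph_Theory.Graph_Theory" "HOL-Library.FuncSet"
begin

text \<open>
  Undirected multigraphs: edges are labels of their own, so parallel edges are distinct edges with
  the same set of ends. Loops are excluded by requiring two ends.
\<close>

record ('v, 'e) multigraph =
  vertices :: "'v set"
  edges :: "'e set"
  ends :: "'e \<Rightarrow> 'v set"

locale finite_multigraph =
  fixes G :: "('v, 'e) multigraph"
  assumes finite_vertices: "finite (vertices G)"
    and finite_edges: "finite (edges G)"
    and ends_subset: "\<And>e. e \<in> edges G \<Longrightarrow> ends G e \<subseteq> vertices G"
    and card_ends: "\<And>e. e \<in> edges G \<Longrightarrow> card (ends G e) = 2"

definition edge_connected :: "nat \<Rightarrow> ('v, 'e) multigraph \<Rightarrow> bool" where
  "edge_connected m G \<longleftrightarrow>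
     (\<forall>S. S \<noteq> {} \<and> S \<subset> vertices G \<longrightarrow> m \<le> card {e \<in> edges G. card (ends G e \<inter> S) = 1})"

definition di_edge_connected :: "nat \<Rightarrow> ('v, 'e) pre_digraph \<Rightarrow> bool" where
  "di_edge_connected k D \<longleftrightarrow>
     (\<forall>S. S \<noteq> {} \<and> S \<subset> verts D \<longrightarrow>
        k \<le> card {a \<in> arcs D. tail D a \<in> S \<and> head D a \<notin> S} \<and>
        k \<le> card {a \<in> arcs D. tail D a \<notin> S \<and> head D a \<in> S})"

text \<open>
  An orientation assigns to each edge one of its two (tail, head) pairs. The extensional function
  space makes orientations equal exactly when they agree on all edges of the graph.
\<close>

definition orientations :: "('v, 'e) multigraph \<Rightarrow> ('e \<Rightarrow> 'v \<times> 'v) set" where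
  "orientations G = (\<Pi>\<^sub>E e\<in>edges G. {(u, v). ends G e = {u, v}})"

definition oriented :: "('v, 'e) multigraph \<Rightarrow> ('e \<Rightarrow> 'v \<times> 'v) \<Rightarrow> ('v, 'e) pre_digraph" where
  "oriented G \<omega> =
     \<lparr> verts = vertices G, arcs = edges G, tail = (\<lambda>e. fst (\<omega> e)), head = (\<lambda>e. snd (\<omega> e)) \<rparr>"

definition flip :: "'e \<Rightarrow> ('e \<Rightarrow> 'v \<times> 'v) \<Rightarrow> ('e \<Rightarrow> 'v \<times> 'v)" where
  "flip e \<omega> = \<omega>(e := prod.swap (\<omega> e))"

definition k_orientations :: "nat \<Rightarrow> ('v, 'e) multigraph \<Rightarrow> ('e \<Rightarrow> 'v \<times> 'v) set" where
  "k_orientations k G = {\<omega> \<in> orientations G. di_edge_connected k (oriented G \<omega>)}"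

text \<open>
  As usual in the digraph library, the undirected edge-flip graph is represented by a symmetric
  digraph; \<open>pair_graph_edge_flip_graph\<close> below shows that it is indeed a finite simple graph.
\<close>

definition edge_flip_graph :: "nat \<Rightarrow> ('v, 'e) multigraph \<Rightarrow> ('e \<Rightarrow> 'v \<times> 'v) pair_pre_digraph" where
  "edge_flip_graph k G =
     \<lparr> pverts = k_orientations k G,
       parcs = {(\<omega>, \<omega>'). \<omega> \<in> k_orientations k G \<and> \<omega>' \<in> k_orientations k G \<and>
                 (\<exists>e \<in> edges G. \<omega>' = flip e \<omega>)} \<rparr>"

lemma flip_flip: "flip e (flip e \<omega>) = \<omega>"
  by (auto simp: flip_def)

lemma flip_in_orientations:
  assumes "\<omega> \<in> orientations G" "e \<in> edges G"
  shows "flip e \<omega> \<in> orientations G"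
  using assms by (auto simp: orientations_def flip_def PiE_iff extensional_def insert_commute split: prod.splits)

context finite_multigraph
begin

lemma orientation_ends_neq:
  assumes "\<omega> \<in> orientations G" "e \<in> edges G"
  shows "fst (\<omega> e) \<noteq> snd (\<omega> e)"
proof
  assume "fst (\<omega> e) = snd (\<omega> e)"
  moreover have "ends G e = {fst (\<omega> e), snd (\<omega> e)}"
    using assms by (auto simp: orientations_def PiE_iff split: prod.splits)
  ultimately show False using card_ends[OF assms(2)] by simp
qed

lemma flip_neq:
  assumes "\<omega> \<in> orientations G" "e \<in> edges G"
  shows "flip e \<omega> \<noteq> \<omega>"
proof
  assume "flip e \<omega> = \<omega>"
  then have "prod.swap (\<omega> e) = \<omega> e"
    by (metis flip_def fun_upd_same)
  then show False using orientation_ends_neq[OF assms] by (metis fst_swap)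
qed

lemma finite_orientations: "finite (orientations G)"
  unfolding orientations_def
proof (rule finite_PiE[OF finite_edges])
  fix e assume e: "e \<in> edges G"
  have "{(u, v). ends G e = {u, v}} \<subseteq> vertices G \<times> vertices G"
    using ends_subset[OF e] by auto
  then show "finite {(u, v). ends G e = {u, v}}"
    using finite_vertices by (meson finite_SigmaI finite_subset)
qed

lemma pair_graph_edge_flip_graph: "pair_graph (edge_flip_graph k G)"
proof
  have sub: "k_orientations k G \<subseteq> orientations G"
    by (auto simp: k_orientations_def)
  show fin: "finite (pverts (edge_flip_graph k G))"
    using sub finite_orientations by (auto simp: edge_flip_graph_def intro: finite_subset)
  have "parcs (edge_flip_graph k G) \<subseteq> pverts (edge_flip_graph k G) \<times> pverts (edge_flip_graph k G)"
    by (auto simp: edge_flip_graph_def)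
  then show "finite (parcs (edge_flip_graph k G))"
    using fin by (meson finite_SigmaI finite_subset)
  show "symmetric (with_proj (edge_flip_graph k G))"
    by (auto simp: symmetric_def edge_flip_graph_def sym_def flip_flip intro!: bexI)
  fix a assume "a \<in> parcs (edge_flip_graph k G)"
  then show "fst a \<in> pverts (edge_flip_graph k G)" "snd a \<in> pverts (edge_flip_graph k G)"
    "fst a \<noteq> snd a"
    using sub flip_neq by (fastforce simp: edge_flip_graph_def)+
qed

end

end

theory Submission
  imports Defs
begin

text \<open>
  Flipping the arc from \<open>u\<close> to \<open>v\<close> changes the in-degree of every vertex set as if a token moved
  from \<open>u\<close> to \<open>v\<close>, and it destroys \<open>k\<close>-edge-connectivity only if a tight set (one with exactly
  \<open>k\<close> entering arcs) contains \<open>v\<close> but not \<open>u\<close>. Fix a \<open>k\<close>-edge-connected orientation and an integer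
  vector \<open>x\<close> of total 0 such that adding \<open>x S\<close> to the in-degree of each proper set \<open>S\<close> gives at least
  \<open>k + 1\<close>. An uncrossing argument shows that some vertex with \<open>x > 0\<close> can send a token along flippable
  arcs to a vertex with \<open>x < 0\<close>, which decreases the \<open>l\<^sub>1\<close> norm of \<open>x\<close>; iterating, the in-degrees
  prescribed by \<open>x\<close> are reached.

  Half of out-degree minus in-degree is such an \<open>x\<close>, except that it is only half-integral; tight sets
  being closed under crossing unions, a parity argument rounds it to an integral one. This yields a
  \<open>(k + 1)\<close>-edge-connected orientation. Conversely, the in-degree vector of any such orientation is a
  valid target for every \<open>k\<close>-edge-connected one, and two orientations with these same in-degrees are
  joined by flipping the arcs in which they differ, following directed trails, so that no cut ever
  loses more than one arc.
\<close>

section \<open>In- and out-degrees of vertex sets, and submodularity\<close>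

definition entering :: "('v, 'e) multigraph \<Rightarrow> ('e \<Rightarrow> 'v \<times> 'v) \<Rightarrow> 'v set \<Rightarrow> int" where
  "entering G \<omega> S = (\<Sum>e\<in>edges G. of_bool (fst (\<omega> e) \<notin> S \<and> snd (\<omega> e) \<in> S))"

definition leaving :: "('v, 'e) multigraph \<Rightarrow> ('e \<Rightarrow> 'v \<times> 'v) \<Rightarrow> 'v set \<Rightarrow> int" where
  "leaving G \<omega> S = (\<Sum>e\<in>edges G. of_bool (fst (\<omega> e) \<in> S \<and> snd (\<omega> e) \<notin> S))"

definition tight :: "nat \<Rightarrow> ('v, 'e) multigraph \<Rightarrow> ('e \<Rightarrow> 'v \<times> 'v) \<Rightarrow> 'v set \<Rightarrow> bool" where
  "tight k G \<omega> M \<longleftrightarrow> M \<noteq> {} \<and> M \<subset> vertices G \<and> entering G \<omega> M = int k"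

text \<open>An arc entering both \<open>S \<inter> T\<close> and \<open>S \<union> T\<close> enters
  both \<open>S\<close> and \<open>T\<close>; an arc entering just one of the former enters at least
  one of the latter.\<close>

lemma entering_Int_Un:
  "entering G \<omega> (S \<inter> T) + entering G \<omega> (S \<union> T) \<le> entering G \<omega> S + entering G \<omega> T"
  unfolding entering_def sum.distrib[symmetric] by (rule sum_mono) (auto simp: of_bool_def)

text \<open>This is submodularity of \<open>entering\<close> for \<open>M\<close> and the complement
  of \<open>N\<close>.\<close>

lemma leaving_entering_Diff:
  "leaving G \<omega> (N - M) + entering G \<omega> (M - N) \<le> leaving G \<omega> N + entering G \<omega> M"
  unfolding entering_def leaving_def sum.distrib[symmetric]
  by (rule sum_mono) (auto simp: of_bool_def)

lemma entering_mono:
  assumes "\<And>e. e \<in> edges G \<Longrightarrow> fst (\<omega> e) \<notin> S \<Longrightarrow> snd (\<omega> e) \<in> S \<Longrightarrow> fst (\<omega> e) \<notin> T \<and> snd (\<omega> e) \<in> T"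
  shows "entering G \<omega> S \<le> entering G \<omega> T"
  unfolding entering_def by (rule sum_mono) (use assms in \<open>auto simp: of_bool_def\<close>)

lemma leaving_mono:
  assumes "\<And>e. e \<in> edges G \<Longrightarrow> fst (\<omega> e) \<in> S \<Longrightarrow> snd (\<omega> e) \<notin> S \<Longrightarrow> fst (\<omega> e) \<in> T \<and> snd (\<omega> e) \<notin> T"
  shows "leaving G \<omega> S \<le> leaving G \<omega> T"
  unfolding leaving_def by (rule sum_mono) (use assms in \<open>auto simp: of_bool_def\<close>)

context finite_multigraph
begin

section \<open>Orientations of a fixed multigraph and their cuts\<close>

lemma orientation_ends:
  assumes "\<omega> \<in> orientations G" "e \<in> edges G"
  shows "ends G e = {fst (\<omega> e), snd (\<omega> e)}"
  using assms by (auto simp: orientations_def PiE_iff split: prod.splits)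

lemma orientation_ends_in:
  assumes "\<omega> \<in> orientations G" "e \<in> edges G"
  shows "fst (\<omega> e) \<in> vertices G" "snd (\<omega> e) \<in> vertices G"
  using orientation_ends[OF assms] ends_subset[OF assms(2)] by auto

lemma orientations_eqI:
  assumes "\<omega> \<in> orientations G" "\<omega>' \<in> orientations G" "\<And>e. e \<in> edges G \<Longrightarrow> \<omega> e = \<omega>' e"
  shows "\<omega> = \<omega>'"
  using assms unfolding orientations_def by (rule PiE_ext)

lemma leaving_compl:
  assumes "\<omega> \<in> orientations G"
  shows "leaving G \<omega> (vertices G - S) = entering G \<omega> S"
  unfolding leaving_def entering_def
  by (rule sum.cong) (use orientation_ends_in[OF assms] in \<open>auto simp: of_bool_def\<close>)

lemma entering_compl:
  assumes "\<omega> \<in> orientations G"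
  shows "entering G \<omega> (vertices G - S) = leaving G \<omega> S"
  unfolding leaving_def entering_def
  by (rule sum.cong) (use orientation_ends_in[OF assms] in \<open>auto simp: of_bool_def\<close>)

lemma leaving_vertices:
  assumes "\<omega> \<in> orientations G"
  shows "leaving G \<omega> (vertices G) = 0"
  unfolding leaving_def using orientation_ends_in[OF assms] by (auto intro!: sum.neutral)

text \<open>The arcs leaving \<open>S\<close> are those entering its complement, so a bound on
  entering arcs over all proper sets yields both halves of connectivity.\<close>

lemma k_orientations_iff:
  "\<omega> \<in> k_orientations k G \<longleftrightarrow> \<omega> \<in> orientations G \<and>
     (\<forall>S. S \<noteq> {} \<longrightarrow> S \<subset> vertices G \<longrightarrow> int k \<le> entering G \<omega> S)"
proof -
  have en: "entering G \<omega> S = int (card {a \<in> edges G. fst (\<omega> a) \<notin> S \<and> snd (\<omega> a) \<in> S})"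
    and le: "leaving G \<omega> S = int (card {a \<in> edges G. fst (\<omega> a) \<in> S \<and> snd (\<omega> a) \<notin> S})" for S
    using finite_edges by (simp_all add: entering_def leaving_def of_bool_def sum.If_cases Int_def)
  have "int k \<le> leaving G \<omega> S"
    if "\<omega> \<in> orientations G" "S \<noteq> {}" "S \<subset> vertices G"
      "\<forall>S. S \<noteq> {} \<longrightarrow> S \<subset> vertices G \<longrightarrow> int k \<le> entering G \<omega> S" for S
    using that(4)[rule_format, of "vertices G - S"] that(2,3) entering_compl[OF that(1), of S]
    by auto
  then show ?thesis
    unfolding k_orientations_def di_edge_connected_def oriented_def
    using en le by auto
qed

lemma k_orientationsD:
  assumes "\<omega> \<in> k_orientations k G"
  shows "\<omega> \<in> orientations G"
    and "\<And>S. S \<noteq> {} \<Longrightarrow> S \<subset> vertices G \<Longrightarrow> int k \<le> entering G \<omega> S"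
    and "\<And>S. S \<noteq> {} \<Longrightarrow> S \<subset> vertices G \<Longrightarrow> int k \<le> leaving G \<omega> S"
proof -
  show o: "\<omega> \<in> orientations G"
    and k: "\<And>S. S \<noteq> {} \<Longrightarrow> S \<subset> vertices G \<Longrightarrow> int k \<le> entering G \<omega> S"
    using assms k_orientations_iff by blast+
  show "int k \<le> leaving G \<omega> S" if "S \<noteq> {}" "S \<subset> vertices G" for S
    using k[of "vertices G - S"] entering_compl[OF o, of S] that by auto
qed

lemma entering_flip:
  assumes "e \<in> edges G"
  shows "entering G (flip e \<omega>) S =
    entering G \<omega> S + of_bool (fst (\<omega> e) \<in> S) - of_bool (snd (\<omega> e) \<in> S)"
proof -
  have "(\<Sum>a\<in>edges G - {e}. of_bool (fst (flip e \<omega> a) \<notin> S \<and> snd (flip e \<omega> a) \<in> S)) =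
    (\<Sum>a\<in>edges G - {e}. of_bool (fst (\<omega> a) \<notin> S \<and> snd (\<omega> a) \<in> S) :: int)"
    by (rule sum.cong) (auto simp: flip_def)
  then show ?thesis
    unfolding entering_def sum.remove[OF finite_edges assms]
    by (auto simp: flip_def)
qed

lemma sum_of_bool_singleton:
  assumes "finite S"
  shows "(\<Sum>v\<in>S. of_bool (a = v)) = (of_bool (a \<in> S) :: int)"
  using assms by (cases "a \<in> S") simp_all

text \<open>The in-degree of \<open>S\<close> is the number of heads in \<open>S\<close> minus the
  number of edges inside \<open>S\<close>, and the latter is the same for all orientations. Hence
  in-degrees of sets are compared by a vector on vertices.\<close>

lemma entering_diff_modular:
  assumes "\<omega> \<in> orientations G" "\<omega>' \<in> orientations G" "S \<subseteq> vertices G"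
  shows "entering G \<omega>' S - entering G \<omega> S =
    (\<Sum>v\<in>S. \<Sum>e\<in>edges G. of_bool (snd (\<omega>' e) = v) - of_bool (snd (\<omega> e) = v))"
proof -
  have "entering G \<omega>' S - entering G \<omega> S =
    (\<Sum>e\<in>edges G. of_bool (snd (\<omega>' e) \<in> S) - of_bool (snd (\<omega> e) \<in> S))"
    unfolding entering_def sum_subtractf[symmetric]
  proof (rule sum.cong[OF refl])
    fix e assume "e \<in> edges G"
    then have "{fst (\<omega> e), snd (\<omega> e)} = {fst (\<omega>' e), snd (\<omega>' e)}"
      using orientation_ends assms by metis
    then show "of_bool (fst (\<omega>' e) \<notin> S \<and> snd (\<omega>' e) \<in> S) -
        of_bool (fst (\<omega> e) \<notin> S \<and> snd (\<omega> e) \<in> S) =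
        (of_bool (snd (\<omega>' e) \<in> S) - of_bool (snd (\<omega> e) \<in> S) :: int)"
      by (auto simp: doubleton_eq_iff of_bool_def)
  qed
  also have "\<dots> = (\<Sum>e\<in>edges G. \<Sum>v\<in>S. of_bool (snd (\<omega>' e) = v) - of_bool (snd (\<omega> e) = v))"
    using sum_of_bool_singleton[OF finite_subset[OF assms(3) finite_vertices]]
    by (simp add: sum_subtractf)
  also have "\<dots> = (\<Sum>v\<in>S. \<Sum>e\<in>edges G. of_bool (snd (\<omega>' e) = v) - of_bool (snd (\<omega> e) = v))"
    by (rule sum.swap)
  finally show ?thesis .
qed

section \<open>Single flips and token walks\<close>

lemma flip_step:
  assumes "\<omega> \<in> k_orientations k G" "e \<in> edges G"
    and "\<And>M. tight k G \<omega> M \<Longrightarrow> snd (\<omega> e) \<in> M \<Longrightarrow> fst (\<omega> e) \<in> M"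
  shows "(\<omega>, flip e \<omega>) \<in> parcs (edge_flip_graph k G)" "flip e \<omega> \<in> k_orientations k G"
proof -
  have "int k \<le> entering G (flip e \<omega>) S" if "S \<noteq> {}" "S \<subset> vertices G" for S
    using assms(3)[of S] k_orientationsD(2)[OF assms(1) that] that
    by (auto simp: entering_flip[OF assms(2)] tight_def of_bool_def)
  then show "flip e \<omega> \<in> k_orientations k G"
    using flip_in_orientations[OF k_orientationsD(1)[OF assms(1)] assms(2)] k_orientations_iff
    by blast
  then show "(\<omega>, flip e \<omega>) \<in> parcs (edge_flip_graph k G)"
    using assms by (auto simp: edge_flip_graph_def)
qed

text \<open>Only tight sets of the initial orientation can block a walk. A set that is tight now and
  misses the current position cannot contain \<open>s\<close>, since its initial in-degree would
  then be below \<open>k\<close>; so it was tight initially and misses \<open>U\<close>.\<close>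

lemma walk_token:
  assumes \<omega>: "\<omega> \<in> k_orientations k G" and s: "s \<in> U" "U \<subseteq> vertices G"
    and U: "\<And>M. tight k G \<omega> M \<Longrightarrow> s \<notin> M \<Longrightarrow> M \<inter> U = {}"
  obtains T where "s \<in> T" "T \<subseteq> U"
    "\<And>e. e \<in> edges G \<Longrightarrow> fst (\<omega> e) \<in> T \<Longrightarrow> snd (\<omega> e) \<in> U \<Longrightarrow> snd (\<omega> e) \<in> T"
    "\<And>t. t \<in> T \<Longrightarrow> \<exists>\<omega>'\<in>k_orientations k G. (\<omega>, \<omega>') \<in> (parcs (edge_flip_graph k G))\<^sup>* \<and>
       (\<forall>S. entering G \<omega>' S = entering G \<omega> S + of_bool (s \<in> S) - of_bool (t \<in> S))"
proof -
  \<comment> \<open>An arc leaving \<open>T\<close> has not been flipped by any walk, because walks only flip arcs inside \<open>T\<close>;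
    this is why the set \<open>T\<close> of reachable positions is closed under the original arcs.\<close>
  define r where "r = {((a, w), (b, w')). \<exists>e\<in>edges G. w e = (a, b) \<and> b \<in> U \<and> w' = flip e w}"
  define T where "T = {t. \<exists>w. ((s, \<omega>), (t, w)) \<in> r\<^sup>*}"
  have inv: "t \<in> U \<and> w \<in> k_orientations k G \<and> (\<omega>, w) \<in> (parcs (edge_flip_graph k G))\<^sup>* \<and>
      (\<forall>S. entering G w S = entering G \<omega> S + of_bool (s \<in> S) - of_bool (t \<in> S)) \<and>
      (\<forall>e\<in>edges G. w e \<noteq> \<omega> e \<longrightarrow> fst (\<omega> e) \<in> T \<and> snd (\<omega> e) \<in> T)"
    if "((s, \<omega>), (t, w)) \<in> r\<^sup>*" for t w
    using that
  proof (induction rule: rtrancl_induct2)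
    case refl
    then show ?case using \<omega> s by auto
  next
    case (step a w b w')
    then obtain e where e: "e \<in> edges G" "w e = (a, b)" "b \<in> U" "w' = flip e w"
      by (auto simp: r_def)
    have T: "a \<in> T" "b \<in> T"
      using step.hyps rtrancl.rtrancl_into_rtrancl[OF step.hyps] by (auto simp: T_def)
    have ent: "entering G w S = entering G \<omega> S + of_bool (s \<in> S) - of_bool (a \<in> S)" for S
      using step.IH by blast
    have "a \<in> M" if M: "tight k G w M" "b \<in> M" for M
    proof (rule ccontr)
      assume a: "a \<notin> M"
      have "int k \<le> entering G \<omega> M" using k_orientationsD(2)[OF \<omega>] M by (auto simp: tight_def)
      with a ent[of M] M have "s \<notin> M" "tight k G \<omega> M"
        by (auto simp: tight_def of_bool_def split: if_splits)
      then show False using U e M by blast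
    qed
    then have "w' \<in> k_orientations k G" "(w, w') \<in> parcs (edge_flip_graph k G)"
      using flip_step[of w k e] step.IH e by auto
    moreover have "entering G w' S = entering G \<omega> S + of_bool (s \<in> S) - of_bool (b \<in> S)" for S
      using ent[of S] entering_flip[OF e(1), of w S] e by simp
    moreover have "fst (\<omega> f) \<in> T \<and> snd (\<omega> f) \<in> T" if "f \<in> edges G" "w' f \<noteq> \<omega> f" for f
    proof (cases "f = e")
      case True
      then show ?thesis using T e step.IH that by (cases "w e = \<omega> e") auto
    qed (use that e step.IH in \<open>auto simp: flip_def\<close>)
    ultimately show ?case using step.IH e by (auto intro: rtrancl.rtrancl_into_rtrancl)
  qed
  show thesis
  proof (rule that[of T])
    show "s \<in> T" by (auto simp: T_def)
    show "T \<subseteq> U" using inv by (auto simp: T_def)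
    fix e assume e: "e \<in> edges G" "fst (\<omega> e) \<in> T" "snd (\<omega> e) \<in> U"
    then obtain w where w: "((s, \<omega>), (fst (\<omega> e), w)) \<in> r\<^sup>*" by (auto simp: T_def)
    show "snd (\<omega> e) \<in> T"
    proof (cases "w e = \<omega> e")
      case True
      then have "((fst (\<omega> e), w), (snd (\<omega> e), flip e w)) \<in> r" using e by (auto simp: r_def)
      then show ?thesis using w by (auto simp: T_def intro: rtrancl.rtrancl_into_rtrancl)
    qed (use inv[OF w] e in auto)
  next
    fix t assume "t \<in> T"
    then show "\<exists>\<omega>'\<in>k_orientations k G. (\<omega>, \<omega>') \<in> (parcs (edge_flip_graph k G))\<^sup>* \<and>
       (\<forall>S. entering G \<omega>' S = entering G \<omega> S + of_bool (s \<in> S) - of_bool (t \<in> S))"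
      using inv by (fastforce simp: T_def)
  qed
qed

section \<open>Uncrossing tight sets and moving tokens towards a target\<close>

lemma tight_Int:
  assumes "\<omega> \<in> k_orientations k G" "tight k G \<omega> M" "tight k G \<omega> M'" "M \<inter> M' \<noteq> {}"
    "M \<union> M' \<subset> vertices G"
  shows "tight k G \<omega> (M \<inter> M')"
proof -
  have "M \<inter> M' \<subset> vertices G" "M \<union> M' \<noteq> {}" using assms(4,5) by blast+
  then have "int k \<le> entering G \<omega> (M \<inter> M')" "int k \<le> entering G \<omega> (M \<union> M')"
    using k_orientationsD(2)[OF assms(1)] assms(4,5) by simp_all
  then show ?thesis using entering_Int_Un[of G \<omega> M M'] assms by (auto simp: tight_def)
qed

text \<open>The search for \<open>s\<close> and \<open>t\<close> is confined to a smallest set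
  \<open>N\<close> that contains a positive vertex and has at most \<open>k\<close> leaving arcs.
  The demand on its complement forces a negative vertex into \<open>N\<close>; minimality restricts
  the tight sets meeting \<open>N\<close> and rules out that all tokens get stuck.\<close>

lemma move_token:
  assumes \<omega>: "\<omega> \<in> k_orientations k G"
    and x0: "sum x (vertices G) = (0::int)"
    and x: "\<And>S. S \<noteq> {} \<Longrightarrow> S \<subset> vertices G \<Longrightarrow> int k + 1 \<le> entering G \<omega> S + sum x S"
    and pos: "p \<in> vertices G" "x p > 0"
  obtains s t \<omega>' where "s \<in> vertices G" "x s > 0" "t \<in> vertices G" "x t < 0"
    "\<omega>' \<in> k_orientations k G" "(\<omega>, \<omega>') \<in> (parcs (edge_flip_graph k G))\<^sup>*"
    "\<And>S. entering G \<omega>' S = entering G \<omega> S + of_bool (s \<in> S) - of_bool (t \<in> S)"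
proof -
  let ?V = "vertices G"
  note o = k_orientationsD(1)[OF \<omega>]
  \<comment> \<open>Asking for at most \<open>k\<close> leaving arcs, not exactly \<open>k\<close>,
    admits the whole vertex set, so that a smallest such set exists.\<close>
  define mixed where "mixed N \<longleftrightarrow> N \<subseteq> ?V \<and> leaving G \<omega> N \<le> int k \<and> (\<exists>s\<in>N. x s > 0)" for N
  have "mixed ?V" using leaving_vertices[OF o] pos by (auto simp: mixed_def)
  then obtain N where N: "mixed N" and least: "\<And>N'. mixed N' \<Longrightarrow> card N \<le> card N'"
    using ex_has_least_nat[of mixed ?V card] by blast
  have NV: "N \<subseteq> ?V" and leN: "leaving G \<omega> N \<le> int k" using N by (auto simp: mixed_def)
  have finN: "finite N" using NV finite_vertices finite_subset by blast
  have min: "\<not> mixed N'" if "N' \<subset> N" for N'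
    using least psubset_card_mono[OF finN that] by fastforce
  \<comment> \<open>The demand is \<open>k + 1\<close> while a tight set has in-degree
    \<open>k\<close>.\<close>
  have xtight: "sum x M > 0" if "tight k G \<omega> M" for M
    using x[of M] that by (auto simp: tight_def)
  \<comment> \<open>Otherwise \<open>N\<close> has positive total and its complement negative total,
    although the complement is entered by at most \<open>k\<close> arcs and demands
    \<open>k + 1\<close>.\<close>
  have neg: "\<exists>t\<in>N. x t < 0"
  proof (rule ccontr)
    assume "\<not> ?thesis"
    then have nn: "\<And>t. t \<in> N \<Longrightarrow> 0 \<le> x t" by force
    obtain s where s: "s \<in> N" "x s > 0" using N by (auto simp: mixed_def)
    have "sum x N > 0" using finN s nn by (meson sum_pos2)
    then have "N \<noteq> ?V" using x0 by auto
    then have "?V - N \<noteq> {}" "?V - N \<subset> ?V" using NV s by auto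
    from x[OF this] have "0 < sum x (?V - N)" using entering_compl[OF o] leN by simp
    moreover have "sum x (?V - N) = - sum x N" using sum_diff[OF finite_vertices NV, of x] x0 by simp
    ultimately show False using \<open>sum x N > 0\<close> by simp
  qed
  \<comment> \<open>Otherwise \<open>N - M\<close> would be a smaller mixed set.\<close>
  have nocross: "M \<inter> N = {} \<or> M \<subseteq> N \<and> N \<noteq> ?V"
    if M: "tight k G \<omega> M" "s \<notin> M" and s: "s \<in> N" "x s > 0" for M s
  proof (rule ccontr)
    assume c: "\<not> ?thesis"
    \<comment> \<open>If \<open>M - N\<close> is nonempty, at least \<open>k\<close> arcs enter it
      and submodularity applies. If it is empty, \<open>N\<close> is the whole vertex set, and the
      arcs leaving \<open>N - M\<close> are the \<open>k\<close> arcs entering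
      \<open>M\<close>.\<close>
    have "leaving G \<omega> (N - M) \<le> int k"
    proof (cases "M \<subseteq> N")
      case True
      then have "N = ?V" using c by blast
      then show ?thesis using leaving_compl[OF o] M by (auto simp: tight_def)
    next
      case False
      then have "int k \<le> entering G \<omega> (M - N)"
        using k_orientationsD(2)[OF \<omega>, of "M - N"] M by (auto simp: tight_def)
      then show ?thesis using leaving_entering_Diff[of G \<omega> N M] leN M by (auto simp: tight_def)
    qed
    then have "mixed (N - M)" using M s NV by (auto simp: mixed_def)
    then show False using min[of "N - M"] c by blast
  qed
  \<comment> \<open>A token can enter the vertices of \<open>U s\<close> from \<open>s\<close> without violating any cut.\<close>
  define U where "U s = {v \<in> N. \<forall>M. tight k G \<omega> M \<longrightarrow> s \<notin> M \<longrightarrow> v \<notin> M}" for s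
  \<comment> \<open>Bundles what \<open>walk_token\<close> provides, so that one set
    \<open>T s\<close> can be chosen for every \<open>s\<close> in \<open>N\<close>.\<close>
  define good where "good s T \<longleftrightarrow> s \<in> T \<and> T \<subseteq> U s \<and>
    (\<forall>e\<in>edges G. fst (\<omega> e) \<in> T \<longrightarrow> snd (\<omega> e) \<in> U s \<longrightarrow> snd (\<omega> e) \<in> T) \<and>
    (\<forall>t\<in>T. \<exists>\<omega>'\<in>k_orientations k G. (\<omega>, \<omega>') \<in> (parcs (edge_flip_graph k G))\<^sup>* \<and>
       (\<forall>S. entering G \<omega>' S = entering G \<omega> S + of_bool (s \<in> S) - of_bool (t \<in> S)))" for s T
  have "\<exists>T. good s T" if "s \<in> N" for s
  proof -
    have "s \<in> U s" "U s \<subseteq> ?V" "\<And>M. tight k G \<omega> M \<Longrightarrow> s \<notin> M \<Longrightarrow> M \<inter> U s = {}"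
      using that NV by (auto simp: U_def)
    from walk_token[OF \<omega> this] show ?thesis unfolding good_def by metis
  qed
  then obtain T where T: "\<And>s. s \<in> N \<Longrightarrow> good s (T s)" by metis
  have "\<exists>s\<in>N. x s > 0 \<and> (\<exists>t\<in>T s. x t < 0)"
  proof (rule ccontr)
    assume stuck: "\<not> ?thesis"
    \<comment> \<open>\<open>R\<close> is everything that tokens from positive vertices of
      \<open>N\<close> can reach. When stuck, it misses the negative vertex of \<open>N\<close>;
      being a smaller set with a positive vertex, it must have more than \<open>k\<close> leaving
      arcs.\<close>
    define R where "R = (\<Union>s\<in>{s\<in>N. x s > 0}. T s)"
    have RN: "R \<subseteq> N" using T by (fastforce simp: R_def good_def U_def)
    have posR: "s \<in> R" if "s \<in> N" "x s > 0" for s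
      using T[OF that(1)] that by (auto simp: R_def good_def)
    have "\<not> x t < 0" if "t \<in> R" for t using that stuck by (auto simp: R_def)
    then have "R \<noteq> N" using neg by blast
    then have "\<not> mixed R" using min RN by blast
    moreover obtain s where "s \<in> N" "x s > 0" using N by (auto simp: mixed_def)
    ultimately have leR: "leaving G \<omega> R > leaving G \<omega> N" using RN NV posR leN
      by (fastforce simp: mixed_def)
    \<comment> \<open>By minimality of \<open>N\<close>, arcs lead from \<open>R\<close> to \<open>N - R\<close>, and each of them enters a tight subset of
      \<open>N\<close>. A least such set \<open>M\<close> is contradictory: no arc can lead from \<open>M \<inter> R\<close> to \<open>M - R\<close>, so
      \<open>M - R\<close> is tight and still entered from \<open>R\<close>.\<close>
    define exit where "exit M \<longleftrightarrow> tight k G \<omega> M \<and> M \<subseteq> N \<and> N \<noteq> ?V \<and>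
      (\<exists>e\<in>edges G. fst (\<omega> e) \<in> R \<and> snd (\<omega> e) \<in> M - R)" for M
    have barrier: "\<exists>M. exit M \<and> fst (\<omega> e) \<notin> M \<and> snd (\<omega> e) \<in> M"
      if e: "e \<in> edges G" "fst (\<omega> e) \<in> R" "snd (\<omega> e) \<in> N - R" for e
    proof -
      obtain s where s: "s \<in> N" "x s > 0" "fst (\<omega> e) \<in> T s" using e by (auto simp: R_def)
      have "snd (\<omega> e) \<notin> T s" using e s by (auto simp: R_def)
      then have "snd (\<omega> e) \<notin> U s" and a: "fst (\<omega> e) \<in> U s" using T[OF s(1)] e s by (auto simp: good_def)
      then obtain M where M: "tight k G \<omega> M" "s \<notin> M" "snd (\<omega> e) \<in> M" using e by (auto simp: U_def)
      then have "fst (\<omega> e) \<notin> M" using a by (auto simp: U_def)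
      then show ?thesis using M nocross[OF M(1,2) s(1,2)] e by (auto simp: exit_def)
    qed
    have "\<exists>e\<in>edges G. fst (\<omega> e) \<in> R \<and> snd (\<omega> e) \<in> N - R"
    proof (rule ccontr)
      assume "\<not> ?thesis"
      then have "leaving G \<omega> R \<le> leaving G \<omega> N" using RN by (intro leaving_mono) blast
      then show False using leR by simp
    qed
    then have "\<exists>M. exit M" using barrier by blast
    then obtain M where M: "exit M" and leastM: "\<And>M'. exit M' \<Longrightarrow> card M \<le> card M'"
      using ex_has_least_nat[of exit _ card] by blast
    have tM: "tight k G \<omega> M" and MN: "M \<subseteq> N" and "N \<noteq> ?V" using M by (auto simp: exit_def)
    have minM: "\<not> exit M'" if "M' \<subset> M" for M'
      using leastM psubset_card_mono[OF finite_subset[OF MN finN] that] by fastforce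
    have "\<exists>s\<in>M. x s > 0" using xtight[OF tM] by (meson not_le sum_nonpos)
    then have MR: "M \<inter> R \<noteq> {}" using posR MN by blast
    have noarc: "\<not> (fst (\<omega> e) \<in> M \<inter> R \<and> snd (\<omega> e) \<in> M - R)" if e: "e \<in> edges G" for e
    proof
      assume c: "fst (\<omega> e) \<in> M \<inter> R \<and> snd (\<omega> e) \<in> M - R"
      then obtain M' where M': "exit M'" "fst (\<omega> e) \<notin> M'" "snd (\<omega> e) \<in> M'"
        using barrier[OF e] MN by blast
      \<comment> \<open>Uncrossing requires a proper union; here it lies in \<open>N\<close>, which
        is proper by the condition \<open>N \<noteq> ?V\<close> in \<open>exit\<close>.\<close>
      have "tight k G \<omega> (M \<inter> M')"
        using \<omega> tM M' c MN NV \<open>N \<noteq> ?V\<close> by (intro tight_Int) (auto simp: exit_def)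
      then have "exit (M \<inter> M')" using M M' c e by (auto simp: exit_def)
      then show False using minM[of "M \<inter> M'"] c M' by blast
    qed
    have "entering G \<omega> (M - R) \<le> entering G \<omega> M" using noarc by (intro entering_mono) blast
    moreover have ne: "M - R \<noteq> {}" "M - R \<subset> ?V" using M by (auto simp: exit_def tight_def)
    ultimately have "tight k G \<omega> (M - R)"
      using k_orientationsD(2)[OF \<omega> ne] tM ne by (auto simp: tight_def)
    then have "exit (M - R)" using M by (auto simp: exit_def)
    then show False using minM[of "M - R"] MR by blast
  qed
  then obtain s t where st: "s \<in> N" "x s > 0" "t \<in> T s" "x t < 0" by blast
  then have "t \<in> N" using T[OF st(1)] by (auto simp: good_def U_def)
  then show thesis using that[of s t] T[OF st(1)] st NV unfolding good_def by blast
qed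

lemma move_all_tokens:
  assumes "\<omega> \<in> k_orientations k G"
    and "sum x (vertices G) = (0::int)"
    and "\<And>S. S \<noteq> {} \<Longrightarrow> S \<subset> vertices G \<Longrightarrow> int k + 1 \<le> entering G \<omega> S + sum x S"
  shows "\<exists>\<omega>'\<in>k_orientations k G. (\<omega>, \<omega>') \<in> (parcs (edge_flip_graph k G))\<^sup>* \<and>
    (\<forall>S\<subseteq>vertices G. entering G \<omega>' S = entering G \<omega> S + sum x S)"
  using assms
proof (induction "nat (\<Sum>v\<in>vertices G. \<bar>x v\<bar>)" arbitrary: \<omega> x rule: less_induct)
  case less
  show ?case
  proof (cases "\<exists>p\<in>vertices G. x p > 0")
    case False
    then have nonpos: "\<And>v. v \<in> vertices G \<Longrightarrow> 0 \<le> - x v" by force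
    have "\<forall>v\<in>vertices G. - x v = 0"
      using sum_nonneg_eq_0_iff[OF finite_vertices nonpos] less.prems(2) by (simp add: sum_negf)
    then have "sum x S = 0" if "S \<subseteq> vertices G" for S using that by (intro sum.neutral) auto
    then show ?thesis using less.prems(1) by auto
  next
    case True
    then obtain p where p: "p \<in> vertices G" "x p > 0" by blast
    obtain s t \<omega>1 where st: "s \<in> vertices G" "x s > 0" "t \<in> vertices G" "x t < 0"
      and \<omega>1: "\<omega>1 \<in> k_orientations k G" "(\<omega>, \<omega>1) \<in> (parcs (edge_flip_graph k G))\<^sup>*"
      and ent: "\<And>S. entering G \<omega>1 S = entering G \<omega> S + of_bool (s \<in> S) - of_bool (t \<in> S)"
      using move_token[OF less.prems p] by metis
    \<comment> \<open>\<open>y\<close> cancels the change of in-degrees, so \<open>entering\<close>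
      plus the remaining demand is the same as before.\<close>
    define y where "y v = x v - of_bool (s = v) + of_bool (t = v)" for v
    have sumy: "sum y S = sum x S - of_bool (s \<in> S) + of_bool (t \<in> S)" if "S \<subseteq> vertices G" for S
      using sum_of_bool_singleton[OF finite_subset[OF that finite_vertices]]
      by (simp add: y_def sum.distrib sum_subtractf)
    have "(\<Sum>v\<in>vertices G. \<bar>y v\<bar>) < (\<Sum>v\<in>vertices G. \<bar>x v\<bar>)"
    proof (rule sum_strict_mono_ex1[OF finite_vertices])
      show "\<forall>v\<in>vertices G. \<bar>y v\<bar> \<le> \<bar>x v\<bar>" using st by (auto simp: y_def)
      show "\<exists>v\<in>vertices G. \<bar>y v\<bar> < \<bar>x v\<bar>"
        using st by (intro bexI[of _ s]) (auto simp: y_def)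
    qed
    then have "nat (\<Sum>v\<in>vertices G. \<bar>y v\<bar>) < nat (\<Sum>v\<in>vertices G. \<bar>x v\<bar>)"
      by (intro nat_less_eq_zless[THEN iffD2]) (auto intro: sum_nonneg)
    moreover have "sum y (vertices G) = 0" using sumy[OF subset_refl] st less.prems(2) by simp
    moreover have "int k + 1 \<le> entering G \<omega>1 S + sum y S" if "S \<noteq> {}" "S \<subset> vertices G" for S
      using less.prems(3)[OF that] ent[of S] sumy[of S] that by auto
    ultimately obtain \<omega>' where "\<omega>' \<in> k_orientations k G"
      "(\<omega>1, \<omega>') \<in> (parcs (edge_flip_graph k G))\<^sup>*"
      "\<forall>S\<subseteq>vertices G. entering G \<omega>' S = entering G \<omega>1 S + sum y S"
      using less.hyps[OF _ \<omega>1(1)] by blast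
    then show ?thesis using \<omega>1(2) ent sumy by (intro bexI[of _ \<omega>']) auto
  qed
qed

section \<open>Reaching a more highly connected orientation\<close>

text \<open>Equal in-degrees are the case \<open>a = b\<close>; the displacement by one token is
  what the induction meets in the middle of a trail. As every proper set has at least
  \<open>k + 1\<close> entering arcs in \<open>\<omega>'\<close>, losing one is harmless.\<close>

lemma flip_to_same_indegrees:
  assumes "\<omega> \<in> orientations G" "\<omega>' \<in> k_orientations (Suc k) G"
    and "a \<in> vertices G" "b \<in> vertices G"
    and "\<And>S. entering G \<omega> S = entering G \<omega>' S + of_bool (a \<in> S) - of_bool (b \<in> S)"
  shows "(\<omega>, \<omega>') \<in> (parcs (edge_flip_graph k G))\<^sup>*"
  using assms
proof (induction "card {e \<in> edges G. \<omega> e \<noteq> \<omega>' e}" arbitrary: \<omega> a b rule: less_induct)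
  case less
  note o' = k_orientationsD(1)[OF less.prems(2)]
  have kconn: "w \<in> k_orientations k G"
    if w: "w \<in> orientations G"
      and ent: "\<And>S. entering G w S = entering G \<omega>' S + of_bool (c \<in> S) - of_bool (d \<in> S)" for w c d
  proof -
    have "int k \<le> entering G w S" if "S \<noteq> {}" "S \<subset> vertices G" for S
      using k_orientationsD(2)[OF less.prems(2) that] by (simp add: ent of_bool_def)
    then show ?thesis using w k_orientations_iff by blast
  qed
  show ?case
  proof (cases "\<forall>e\<in>edges G. \<omega> e = \<omega>' e")
    case True
    then show ?thesis using orientations_eqI[OF less.prems(1) o'] by auto
  next
    case False
    \<comment> \<open>If \<open>a \<noteq> b\<close>, the vertex \<open>b\<close> lacks one entering
      arc, so some arc that leaves it enters it in \<open>\<omega>'\<close>, and the trail continues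
      there. If \<open>a = b\<close>, any differing arc starts a new trail.\<close>
    have "\<exists>e\<in>edges G. \<omega> e \<noteq> \<omega>' e \<and> (a \<noteq> b \<longrightarrow> fst (\<omega> e) = b)"
    proof (cases "a = b")
      case ab: False
      show ?thesis
      proof (rule ccontr)
        assume c: "\<not> ?thesis"
        have "entering G \<omega>' {b} \<le> entering G \<omega> {b}"
          unfolding entering_def
        proof (rule sum_mono)
          fix e assume e: "e \<in> edges G"
          have "{fst (\<omega> e), snd (\<omega> e)} = {fst (\<omega>' e), snd (\<omega>' e)}"
            using orientation_ends[OF less.prems(1) e] orientation_ends[OF o' e] by simp
          then show "of_bool (fst (\<omega>' e) \<notin> {b} \<and> snd (\<omega>' e) \<in> {b}) \<le>
              (of_bool (fst (\<omega> e) \<notin> {b} \<and> snd (\<omega> e) \<in> {b}) :: int)"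
            using c e ab by (auto simp: doubleton_eq_iff of_bool_def)
        qed
        then show False using less.prems(5)[of "{b}"] ab by simp
      qed
    qed (use False in auto)
    then obtain e where e: "e \<in> edges G" "\<omega> e \<noteq> \<omega>' e" "a \<noteq> b \<longrightarrow> fst (\<omega> e) = b" by blast
    have swap: "flip e \<omega> e = \<omega>' e"
    proof -
      obtain p q p' q' where "\<omega> e = (p, q)" "\<omega>' e = (p', q')" by fastforce
      then show ?thesis
        using orientation_ends[OF less.prems(1) e(1)] orientation_ends[OF o' e(1)] e(2)
        by (auto simp: flip_def doubleton_eq_iff)
    qed
    have fo: "flip e \<omega> \<in> orientations G" by (rule flip_in_orientations[OF less.prems(1) e(1)])
    define a' where "a' = (if a = b then fst (\<omega> e) else a)"
    have ent: "entering G (flip e \<omega>) S =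
        entering G \<omega>' S + of_bool (a' \<in> S) - of_bool (snd (\<omega> e) \<in> S)" for S
      using entering_flip[OF e(1), of \<omega> S] less.prems(5)[of S] e(3) by (auto simp: a'_def)
    have "{f \<in> edges G. flip e \<omega> f \<noteq> \<omega>' f} \<subset> {f \<in> edges G. \<omega> f \<noteq> \<omega>' f}"
      using e swap by (auto simp: flip_def split: if_splits)
    then have "card {f \<in> edges G. flip e \<omega> f \<noteq> \<omega>' f} < card {f \<in> edges G. \<omega> f \<noteq> \<omega>' f}"
      using finite_edges by (intro psubset_card_mono) auto
    moreover have "a' \<in> vertices G" "snd (\<omega> e) \<in> vertices G"
      using less.prems(3) orientation_ends_in[OF less.prems(1) e(1)] by (auto simp: a'_def)
    ultimately have "(flip e \<omega>, \<omega>') \<in> (parcs (edge_flip_graph k G))\<^sup>*"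
      using less.hyps[OF _ fo less.prems(2)] ent by blast
    moreover have "(\<omega>, flip e \<omega>) \<in> parcs (edge_flip_graph k G)"
      using kconn[OF less.prems(1,5)] kconn[OF fo ent] e(1) by (auto simp: edge_flip_graph_def)
    ultimately show ?thesis by (meson converse_rtrancl_into_rtrancl)
  qed
qed

lemma flip_to_more_connected:
  assumes "\<omega> \<in> k_orientations k G" "\<omega>' \<in> k_orientations (Suc k) G"
  shows "(\<omega>, \<omega>') \<in> (parcs (edge_flip_graph k G))\<^sup>*"
proof -
  note o = k_orientationsD(1)[OF assms(1)] k_orientationsD(1)[OF assms(2)]
  define x where "x v = (\<Sum>e\<in>edges G. of_bool (snd (\<omega>' e) = v) - of_bool (snd (\<omega> e) = v) :: int)" for v
  have sumx: "sum x S = entering G \<omega>' S - entering G \<omega> S" if "S \<subseteq> vertices G" for S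
    unfolding entering_diff_modular[OF o that] by (simp add: x_def)
  have "sum x (vertices G) = 0"
    using sumx[OF subset_refl] entering_compl[OF o(1), of "{}"] entering_compl[OF o(2), of "{}"]
    by (simp add: leaving_def)
  moreover have "int k + 1 \<le> entering G \<omega> S + sum x S" if "S \<noteq> {}" "S \<subset> vertices G" for S
    using sumx[of S] k_orientationsD(2)[OF assms(2) that] that by auto
  ultimately obtain w where w: "w \<in> k_orientations k G" "(\<omega>, w) \<in> (parcs (edge_flip_graph k G))\<^sup>*"
    "\<forall>S\<subseteq>vertices G. entering G w S = entering G \<omega> S + sum x S"
    using move_all_tokens[OF assms(1)] by blast
  \<comment> \<open>The in-degrees are matched only on subsets of \<open>vertices G\<close>, but
    \<open>flip_to_same_indegrees\<close> speaks of arbitrary sets.\<close>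
  have restrict: "entering G v S = entering G v (S \<inter> vertices G)" if "v \<in> orientations G" for v S
    unfolding entering_def by (rule sum.cong) (use orientation_ends_in[OF that] in auto)
  have ent: "entering G w S = entering G \<omega>' S" for S
    using w(3) sumx[of "S \<inter> vertices G"] restrict[OF o(2), of S]
      restrict[OF k_orientationsD(1)[OF w(1)], of S] by simp
  have "(w, \<omega>') \<in> (parcs (edge_flip_graph k G))\<^sup>*"
  \<comment> \<open>A closed trail still needs some base vertex \<open>a\<close>; without vertices
    there are no edges to flip.\<close>
  proof (cases "vertices G = {}")
    case True
    then have "edges G = {}" using ends_subset card_ends by fastforce
    then have "w = \<omega>'" using orientations_eqI[OF k_orientationsD(1)[OF w(1)] o(2)] by simp
    then show ?thesis by simp
  next
    case False
    then obtain a where "a \<in> vertices G" by blast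
    then show ?thesis
      using flip_to_same_indegrees[OF k_orientationsD(1)[OF w(1)] assms(2), of a a] ent by simp
  qed
  then show ?thesis using w(2) by simp
qed

section \<open>Rounding, and raising the connectivity by one\<close>

text \<open>Meant for \<open>f\<close> twice the in-degree, so that an even solution can be halved.
  Units are shifted between pairs of odd vertices; evenness of \<open>f\<close> and \<open>c\<close>
  gives every set attaining the bound an even total, which leaves an odd vertex free to pair with
  \<open>u\<close>.\<close>

lemma round_to_even:
  fixes f :: "'v set \<Rightarrow> int" and y :: "'v \<Rightarrow> int"
  assumes sub: "\<And>S T. f (S \<inter> T) + f (S \<union> T) \<le> f S + f T"
    and ev: "\<And>S. even (f S)" "even c"
    and "sum y (vertices G) = 0"
    and "\<And>S. S \<noteq> {} \<Longrightarrow> S \<subset> vertices G \<Longrightarrow> c \<le> f S + sum y S"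
  shows "\<exists>z. sum z (vertices G) = 0 \<and> (\<forall>v\<in>vertices G. even (z v)) \<and>
    (\<forall>S. S \<noteq> {} \<longrightarrow> S \<subset> vertices G \<longrightarrow> c \<le> f S + sum z S)"
  using assms(4,5)
proof (induction "card {v \<in> vertices G. odd (y v)}" arbitrary: y rule: less_induct)
  case less
  let ?V = "vertices G"
  show ?case
  proof (cases "\<forall>v\<in>?V. even (y v)")
    case True
    then show ?thesis using less.prems by blast
  next
    case False
    then obtain u where u: "u \<in> ?V" "odd (y u)" by blast
    \<comment> \<open>These are the sets that would be violated by taking a unit from one of their
      vertices and giving it to \<open>u\<close>. All of them miss \<open>u\<close>, so unions stay
      proper and the maximal members are disjoint; hence the total over their union is even.\<close>
    define \<T> where "\<T> = {M. M \<noteq> {} \<and> M \<subseteq> ?V - {u} \<and> f M + sum y M = c}"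
    define \<M> where "\<M> = {M \<in> \<T>. \<forall>M'\<in>\<T>. M \<subseteq> M' \<longrightarrow> M' = M}"
    have fin\<T>: "finite \<T>" unfolding \<T>_def using finite_vertices by simp
    have Un: "M \<union> M' \<in> \<T>" if M: "M \<in> \<T>" "M' \<in> \<T>" "M \<inter> M' \<noteq> {}" for M M'
    proof -
      have "finite M" "finite M'" using M finite_vertices by (auto simp: \<T>_def intro: finite_subset)
      then have "sum y (M \<union> M') + sum y (M \<inter> M') = sum y M + sum y M'" by (rule sum.union_inter)
      moreover have "c \<le> f (M \<union> M') + sum y (M \<union> M')" "c \<le> f (M \<inter> M') + sum y (M \<inter> M')"
        using M u by (intro less.prems(2); auto simp: \<T>_def)+
      ultimately show ?thesis using sub[of M M'] M by (auto simp: \<T>_def)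
    qed
    have disj: "\<forall>A\<in>\<M>. \<forall>B\<in>\<M>. A \<noteq> B \<longrightarrow> A \<inter> B = {}"
      using Un unfolding \<M>_def by (smt (verit) Un_upper1 Un_upper2 mem_Collect_eq)
    have cover: "\<exists>A\<in>\<M>. M \<subseteq> A" if "M \<in> \<T>" for M
      using finite_has_maximal2[OF fin\<T> that] by (auto simp: \<M>_def)
    have "even (sum y M)" if "M \<in> \<M>" for M
    proof -
      have "sum y M = c - f M" using that by (auto simp: \<M>_def \<T>_def)
      then show ?thesis using ev by simp
    qed
    moreover have "\<forall>A\<in>\<M>. finite A"
      unfolding \<M>_def \<T>_def using finite_vertices by (blast intro: finite_subset)
    then have "sum y (\<Union>\<M>) = (\<Sum>M\<in>\<M>. sum y M)"
      using sum.Union_disjoint[OF _ disj, of y] by simp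
    ultimately have evU: "even (sum y (\<Union>\<M>))" by (simp add: dvd_sum)
    have UV: "\<Union>\<M> \<subseteq> ?V - {u}" by (auto simp: \<M>_def \<T>_def)
    \<comment> \<open>A vertex \<open>v\<close> in no tight set avoiding \<open>u\<close> allows shifting one unit from \<open>v\<close> to \<open>u\<close>; parity
      provides an odd one.\<close>
    obtain v where v: "v \<in> ?V" "v \<noteq> u" "odd (y v)" "v \<notin> \<Union>\<M>"
    proof (rule ccontr)
      assume "\<not> thesis"
      with that have "\<forall>v\<in>?V - {u} - \<Union>\<M>. even (y v)" by blast
      then have "even (sum y (?V - {u} - \<Union>\<M>))" by (intro dvd_sum) blast
      moreover have "sum y (?V - {u}) = sum y (?V - {u} - \<Union>\<M>) + sum y (\<Union>\<M>)"
        using UV finite_vertices by (intro sum.subset_diff) auto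
      moreover have "sum y ?V = y u + sum y (?V - {u})"
        using u finite_vertices by (intro sum.remove)
      ultimately show False using evU u less.prems(1) by (metis even_add even_zero)
    qed
    define z where "z w = y w + of_bool (u = w) - of_bool (v = w)" for w
    have sumz: "sum z S = sum y S + of_bool (u \<in> S) - of_bool (v \<in> S)" if "S \<subseteq> ?V" for S
      using sum_of_bool_singleton[OF finite_subset[OF that finite_vertices]]
      by (simp add: z_def sum.distrib sum_subtractf)
    have "{w \<in> ?V. odd (z w)} \<subset> {w \<in> ?V. odd (y w)}" using u v by (auto simp: z_def)
    then have "card {w \<in> ?V. odd (z w)} < card {w \<in> ?V. odd (y w)}"
      using finite_vertices by (intro psubset_card_mono) auto
    moreover have "sum z ?V = 0" using sumz[OF subset_refl] u v less.prems(1) by simp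
    moreover have "c \<le> f S + sum z S" if S: "S \<noteq> {}" "S \<subset> ?V" for S
    proof (cases "v \<in> S \<and> u \<notin> S")
      case True
      \<comment> \<open>As \<open>v\<close> lies in no maximal member of \<open>\<T>\<close>, it
        lies in no member, so \<open>S\<close> has slack and can lose one unit.\<close>
      then have "S \<notin> \<T>" using cover v by blast
      then have "c \<noteq> f S + sum y S" using S True by (auto simp: \<T>_def)
      then show ?thesis using less.prems(2)[OF S] sumz[of S] S True by auto
    next
      case False
      then show ?thesis using less.prems(2)[OF S] sumz[of S] S by auto
    qed
    ultimately show ?thesis using less.hyps by blast
  qed
qed

text \<open>In-degree plus half of out-degree minus in-degree is half the cut, hence at least
  \<open>k + 1\<close>. \<open>round_to_even\<close> is applied to the doubled inequality, and half
  of its result is an integral target for \<open>move_all_tokens\<close>.\<close>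

lemma raise_connectivity:
  assumes \<omega>: "\<omega> \<in> k_orientations k G" and conn: "edge_connected (2 * k + 2) G"
  shows "k_orientations (Suc k) G \<noteq> {}"
proof -
  note o = k_orientationsD(1)[OF \<omega>]
  define y where "y v = (\<Sum>e\<in>edges G. of_bool (fst (\<omega> e) = v) - of_bool (snd (\<omega> e) = v) :: int)" for v
  have sumy: "sum y S = leaving G \<omega> S - entering G \<omega> S" if "S \<subseteq> vertices G" for S
  proof -
    have "sum y S = (\<Sum>e\<in>edges G. \<Sum>v\<in>S. of_bool (fst (\<omega> e) = v) - of_bool (snd (\<omega> e) = v))"
      unfolding y_def by (rule sum.swap)
    also have "\<dots> = (\<Sum>e\<in>edges G. of_bool (fst (\<omega> e) \<in> S) - of_bool (snd (\<omega> e) \<in> S))"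
      using sum_of_bool_singleton[OF finite_subset[OF that finite_vertices]] by (simp add: sum_subtractf)
    also have "\<dots> = leaving G \<omega> S - entering G \<omega> S"
      unfolding leaving_def entering_def sum_subtractf[symmetric]
      by (rule sum.cong) (auto simp: of_bool_def)
    finally show ?thesis .
  qed
  have cut: "2 * int k + 2 \<le> leaving G \<omega> S + entering G \<omega> S" if "S \<noteq> {}" "S \<subset> vertices G" for S
  proof -
    have crossing: "card (ends G e \<inter> S) = 1 \<longleftrightarrow> (fst (\<omega> e) \<in> S) \<noteq> (snd (\<omega> e) \<in> S)"
      if e: "e \<in> edges G" for e
      using orientation_ends[OF o e] orientation_ends_neq[OF o e] by (auto simp: Int_insert_left)
    have "2 * k + 2 \<le> card {e \<in> edges G. card (ends G e \<inter> S) = 1}"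
      using conn that by (auto simp: edge_connected_def)
    also have "{e \<in> edges G. card (ends G e \<inter> S) = 1} =
        {e \<in> edges G. (fst (\<omega> e) \<in> S) \<noteq> (snd (\<omega> e) \<in> S)}" using crossing by blast
    also have "int (card \<dots>) = (\<Sum>e\<in>edges G. of_bool ((fst (\<omega> e) \<in> S) \<noteq> (snd (\<omega> e) \<in> S)))"
      using finite_edges by (simp add: of_bool_def sum.If_cases Int_def)
    also have "\<dots> = leaving G \<omega> S + entering G \<omega> S"
      unfolding leaving_def entering_def sum.distrib[symmetric]
      by (rule sum.cong) (auto simp: of_bool_def)
    finally show ?thesis by simp
  qed
  have "\<exists>z. sum z (vertices G) = 0 \<and> (\<forall>v\<in>vertices G. even (z v)) \<and>
    (\<forall>S. S \<noteq> {} \<longrightarrow> S \<subset> vertices G \<longrightarrow> 2 * int k + 2 \<le> 2 * entering G \<omega> S + sum z S)"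
  proof (rule round_to_even)
    show "2 * entering G \<omega> (S \<inter> T) + 2 * entering G \<omega> (S \<union> T) \<le> 2 * entering G \<omega> S + 2 * entering G \<omega> T" for S T
      using entering_Int_Un[of G \<omega> S T] by simp
    show "sum y (vertices G) = 0"
      using sumy[OF subset_refl] leaving_vertices[OF o] entering_compl[OF o, of "{}"]
      by (simp add: leaving_def)
    show "2 * int k + 2 \<le> 2 * entering G \<omega> S + sum y S" if "S \<noteq> {}" "S \<subset> vertices G" for S
      using cut[OF that] sumy[of S] that by auto
  qed simp_all
  then obtain z where z: "sum z (vertices G) = 0" "\<And>v. v \<in> vertices G \<Longrightarrow> even (z v)"
    "\<And>S. S \<noteq> {} \<Longrightarrow> S \<subset> vertices G \<Longrightarrow> 2 * int k + 2 \<le> 2 * entering G \<omega> S + sum z S" by blast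
  define x where "x v = z v div 2" for v
  have sumx: "2 * sum x S = sum z S" if "S \<subseteq> vertices G" for S
    unfolding sum_distrib_left by (rule sum.cong) (use z(2) that in \<open>auto simp: x_def\<close>)
  have "sum x (vertices G) = 0" using sumx[OF subset_refl] z(1) by simp
  moreover have xk: "int k + 1 \<le> entering G \<omega> S + sum x S" if "S \<noteq> {}" "S \<subset> vertices G" for S
    using sumx[of S] z(3)[OF that] that by auto
  ultimately obtain w where w: "w \<in> k_orientations k G"
    and "\<forall>S\<subseteq>vertices G. entering G w S = entering G \<omega> S + sum x S"
    using move_all_tokens[OF \<omega>] by blast
  then have "int (Suc k) \<le> entering G w S" if "S \<noteq> {}" "S \<subset> vertices G" for S
    using xk[OF that] that by auto
  then have "w \<in> k_orientations (Suc k) G"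
    using k_orientationsD(1)[OF w] k_orientations_iff by blast
  then show ?thesis by blast
qed

text \<open>The weak orientation theorem of Nash-Williams, obtained from an arbitrary orientation by
  raising the connectivity one unit at a time.\<close>

lemma k_orientations_nonempty:
  assumes "edge_connected (2 * k) G"
  shows "k_orientations k G \<noteq> {}"
  using assms
proof (induction k)
  case 0
  have "\<exists>p. ends G e = {fst p, snd p}" if "e \<in> edges G" for e
    using card_ends[OF that] by (auto simp: card_2_iff)
  then obtain \<omega> where "\<And>e. e \<in> edges G \<Longrightarrow> ends G e = {fst (\<omega> e), snd (\<omega> e)}" by metis
  then have "restrict \<omega> (edges G) \<in> orientations G"
    by (auto simp: orientations_def split: prod.splits)
  then show ?case by (auto simp: k_orientations_def di_edge_connected_def)
next
  case (Suc k)
  then have conn: "edge_connected (2 * k + 2) G" by simp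
  then have "edge_connected (2 * k) G" unfolding edge_connected_def by (meson add_leD1)
  then show ?case using Suc.IH raise_connectivity conn by blast
qed

end

section \<open>Connectedness of the edge-flip graph\<close>

theorem theorem2:
  fixes G :: "('v, 'e) multigraph" and k :: nat
  assumes "k \<ge> 1"
    and "finite_multigraph G"
    and "edge_connected (2 * k + 2) G"
  shows "Digraph_Component.connected (with_proj (edge_flip_graph k G))"
proof -
  interpret finite_multigraph G by fact
  interpret pair_graph "edge_flip_graph k G" by (rule pair_graph_edge_flip_graph)
  let ?H = "edge_flip_graph k G"
  have conn: "edge_connected (2 * Suc k) G" using assms(3) by simp
  \<comment> \<open>\<open>\<omega>0\<close> serves as a hub: every \<open>k\<close>-edge-connected
    orientation has a flip sequence to it, and flips are reversible.\<close>
  obtain \<omega>0 where \<omega>0: "\<omega>0 \<in> k_orientations (Suc k) G" using k_orientations_nonempty[OF conn] by blast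
  have "int k \<le> entering G \<omega>0 S" if "S \<noteq> {}" "S \<subset> vertices G" for S
    using k_orientationsD(2)[OF \<omega>0 that] by simp
  then have verts: "\<omega>0 \<in> k_orientations k G"
    using k_orientationsD(1)[OF \<omega>0] k_orientations_iff by blast
  have sym: "sym (parcs ?H)"
    using symmetric_def[of "with_proj ?H"] sym_arcs by simp
  have "(u, v) \<in> rtrancl_on (pverts ?H) (parcs ?H)" if "u \<in> pverts ?H" "v \<in> pverts ?H" for u v
  proof -
    have "(u, \<omega>0) \<in> (parcs ?H)\<^sup>*" "(v, \<omega>0) \<in> (parcs ?H)\<^sup>*"
      using that flip_to_more_connected[OF _ \<omega>0] by (auto simp: edge_flip_graph_def)
    then have "(u, v) \<in> (parcs ?H)\<^sup>*"
      using symD[OF sym_rtrancl[OF sym]] by (meson rtrancl_trans)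
    then show ?thesis
      by (rule rtrancl_consistent_rtrancl_on)
        (use that in_arcsD1 in_arcsD2 in \<open>auto simp: edge_flip_graph_def\<close>)
  qed
  then have "\<forall>u\<in>pverts ?H. \<forall>v\<in>pverts ?H. u \<rightarrow>\<^sup>*\<^bsub>with_proj ?H\<^esub> v" by (simp add: reachable_def)
  then show ?thesis
    using verts reachable_mk_symmetricI
    by (auto simp: Digraph_Component.connected_def strongly_connected_def edge_flip_graph_def)
qed

end
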